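(* For every integer $e\ge 3$ there exists, for some $n\equiv 0\pmod{2e}$, a strongly equitable uniquely $2$-chromatic $e$-star system of order $n$.
   Context: An $e$-star is the complete bipartite graph $K_{1,e}$. An $e$-star system of order $n$ is a pair $(V,\mathcal B)$ where $|V|=n$ and $\mathcal B$ is a set of $e$-stars (subgraphs of the complete graph $K_n$ on $V$) whose edge sets partition the edge set of $K_n$. An $e$-star system is $k$-colourable if $V$ can be partitioned into $k$ sets (colour classes) such that no star in $\mathcal B$ has all its vertices in the same class; it is $k$-chromatic if it is $k$-colourable but not $(k-1)$-colourable. It is uniquely $k$-colourable if any two $k$-colourings differ only by a permutation of the colours (i.e. induce the same partition of $V$). A colouring is strongly equitable if all colour classes have the same size. A strongly equitable uniquely $k$-chromatic system is one that is $k$-chromatic, uniquely $k$-colourable, and whose $k$-colouring is strongly equitable. *)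

theory Defs
  imports "HOL-Library.Disjoint_Sets" "HOL-Number_Theory.Cong" "HOL-Combinatorics.Permutations"
begin

type_synonym 'a subgraph = "'a set \<times> 'a set set"

definition complete_edges :: "'a set \<Rightarrow> 'a set set" where
  "complete_edges V = {{x, y} | x y. x \<in> V \<and> y \<in> V \<and> x \<noteq> y}"

definition is_star :: "nat \<Rightarrow> 'a subgraph \<Rightarrow> bool" where
  "is_star e S \<longleftrightarrow>
     (\<exists>c L. finite L \<and> card L = e \<and> c \<notin> L \<and> S = (insert c L, {{c, x} | x. x \<in> L}))"

definition star_system :: "nat \<Rightarrow> nat \<Rightarrow> 'a set \<Rightarrow> 'a subgraph set \<Rightarrow> bool" where
  "star_system e n V B \<longleftrightarrow>
     finite V \<and> card V = n \<and>
     (\<forall>S\<in>B. is_star e S \<and> fst S \<subseteq> V) \<and>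
     inj_on snd B \<and> partition_on (complete_edges V) (snd ` B)"

definition colour_class :: "'a set \<Rightarrow> ('a \<Rightarrow> nat) \<Rightarrow> nat \<Rightarrow> 'a set" where
  "colour_class V f i = {v \<in> V. f v = i}"

text \<open>Colour classes may be empty; only the values of the colouring on the vertex set matter.\<close>

definition colouring :: "nat \<Rightarrow> 'a set \<Rightarrow> 'a subgraph set \<Rightarrow> ('a \<Rightarrow> nat) \<Rightarrow> bool" where
  "colouring k V B f \<longleftrightarrow>
     f ` V \<subseteq> {..<k} \<and> (\<forall>S\<in>B. \<not> (\<exists>i<k. fst S \<subseteq> colour_class V f i))"

definition colourable :: "nat \<Rightarrow> 'a set \<Rightarrow> 'a subgraph set \<Rightarrow> bool" where
  "colourable k V B \<longleftrightarrow> (\<exists>f. colouring k V B f)"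

definition chromatic :: "nat \<Rightarrow> 'a set \<Rightarrow> 'a subgraph set \<Rightarrow> bool" where
  "chromatic k V B \<longleftrightarrow> colourable k V B \<and> \<not> colourable (k - 1) V B"

definition uniquely_colourable :: "nat \<Rightarrow> 'a set \<Rightarrow> 'a subgraph set \<Rightarrow> bool" where
  "uniquely_colourable k V B \<longleftrightarrow>
     colourable k V B \<and>
     (\<forall>f g. colouring k V B f \<longrightarrow> colouring k V B g \<longrightarrow>
        (\<exists>p. p permutes {..<k} \<and> (\<forall>v\<in>V. g v = p (f v))))"

definition strongly_equitable :: "nat \<Rightarrow> 'a set \<Rightarrow> ('a \<Rightarrow> nat) \<Rightarrow> bool" where
  "strongly_equitable k V f \<longleftrightarrow>
     (\<forall>i<k. \<forall>j<k. card (colour_class V f i) = card (colour_class V f j))"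

definition strongly_equitable_uniquely_chromatic ::
    "nat \<Rightarrow> 'a set \<Rightarrow> 'a subgraph set \<Rightarrow> bool" where
  "strongly_equitable_uniquely_chromatic k V B \<longleftrightarrow>
     chromatic k V B \<and> uniquely_colourable k V B \<and>
     (\<forall>f. colouring k V B f \<longrightarrow> strongly_equitable k V f)"

end

theory Submission imports Defs begin

text \<open>
  The vertices are the numbers below 2et, split into t groups of 2e consecutive numbers, and the
  colouring to be forced is parity. Orient the complete graph so that every vertex beats all
  vertices of earlier groups and, inside its own group, e vertices or none. Then all out-degrees
  are multiples of e, and any partition of the out-neighbourhoods into e-sets is a star system.
  Both parities are equally frequent in earlier groups, so these partitions can be chosen with
  every star bichromatic while still containing a few prescribed stars.

  Prescribed stars make the colouring unique. Let X be the even vertices of the first two groups,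
  so that some e-subset of X is monochromatic, say of colour a. Every e-subset of X is the leaf set
  of stars centred at all odd vertices of one group; so the odd vertices of one group have colour
  1 - a. All these odd cells are leaf sets of stars centred at the even vertices of a later group
  q, which therefore have colour a. These cells in turn force all vertices of later groups.
  Finally, each early vertex is the one leaf of opposite parity in a star whose centre and other
  leaves are late.\<close>

section \<open>Star systems from orientations of the complete graph\<close>

definition star :: "'a \<Rightarrow> 'a set \<Rightarrow> 'a subgraph" where
  "star c L = (insert c L, {{c, x} | x. x \<in> L})"

definition stars :: "'a set \<Rightarrow> ('a \<Rightarrow> 'a set set) \<Rightarrow> 'a subgraph set" where
  "stars V P = {star c L | c L. c \<in> V \<and> L \<in> P c}"

text \<open>Each edge is oriented out of exactly one of its ends. That end has to be the centre of
  the star containing the edge, and the block at that centre holding the other end has to be the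
  leaf set. So every edge lies in exactly one star.\<close>

lemma star_system_stars:
  assumes "finite V" "e > 0"
    and tour: "\<And>x y. x \<in> V \<Longrightarrow> y \<in> V \<Longrightarrow> x \<noteq> y \<Longrightarrow> (y \<in> out x) \<noteq> (x \<in> out y)"
    and out: "\<And>x. x \<in> V \<Longrightarrow> out x \<subseteq> V - {x}"
    and P: "\<And>x. x \<in> V \<Longrightarrow> partition_on (out x) (P x)"
    and card: "\<And>x L. x \<in> V \<Longrightarrow> L \<in> P x \<Longrightarrow> card L = e"
  shows "star_system e (card V) V (stars V P)"
proof -
  have sub: "L \<subseteq> out c" if "c \<in> V" "L \<in> P c" for c L
    using P[OF that(1)] that(2) by (auto simp: partition_on_def)
  \<comment> \<open>A single edge determines centre and leaf set: orientation fixes the centre,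
    disjointness of the blocks fixes the leaves. Both the injectivity of \<open>snd\<close> and the
    disjointness of the edge sets reduce to this.\<close>
  have eq: "c = c' \<and> L = L'"
    if "c \<in> V" "L \<in> P c" "c' \<in> V" "L' \<in> P c'" "x \<in> L" "x' \<in> L'" "{c, x} = {c', x'}"
    for c L c' L' x x'
  proof -
    have x: "x \<in> out c" "x' \<in> out c'" "x \<in> V" "x' \<in> V" "x \<noteq> c" "x' \<noteq> c'"
      using sub[OF that(1,2)] sub[OF that(3,4)] that(5,6) out[OF that(1)] out[OF that(3)] by auto
    have "c = c'" "x = x'"
      using x that(7) tour[of c x] that(1) by (auto simp: doubleton_eq_iff)
    moreover have "disjoint (P c)"
      using P[OF that(1)] by (simp add: partition_on_def)
    ultimately show ?thesis
      using that(2,4,5,6) by (auto simp: disjoint_def)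
  qed
  have ne: "L \<noteq> {}" "finite L" if "c \<in> V" "L \<in> P c" for c L
    using card[OF that] \<open>e > 0\<close> by (auto intro: card_ge_0_finite)
  have "is_star e S \<and> fst S \<subseteq> V" if "S \<in> stars V P" for S
  proof -
    from that obtain c L where c: "c \<in> V" "L \<in> P c" "S = star c L"
      by (auto simp: stars_def)
    have "c \<notin> L" "L \<subseteq> V"
      using sub[OF c(1,2)] out[OF c(1)] by auto
    with c show ?thesis
      unfolding is_star_def star_def using ne[OF c(1,2)] card[OF c(1,2)] by auto
  qed
  moreover have "inj_on snd (stars V P)"
  proof (rule inj_onI)
    fix S S' assume S: "S \<in> stars V P" "S' \<in> stars V P" "snd S = snd S'"
    obtain c L where c: "c \<in> V" "L \<in> P c" "S = star c L"
      using S(1) by (auto simp: stars_def)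
    obtain c' L' where c': "c' \<in> V" "L' \<in> P c'" "S' = star c' L'"
      using S(2) by (auto simp: stars_def)
    obtain x where x: "x \<in> L" using ne[OF c(1,2)] by blast
    have "{c, x} \<in> snd S'" using S(3) c x by (auto simp: star_def)
    then obtain x' where x': "x' \<in> L'" "{c, x} = {c', x'}" using c' by (auto simp: star_def)
    show "S = S'" using eq[OF c(1,2) c'(1,2) x x'] c(3) c'(3) by simp
  qed
  moreover have "partition_on (complete_edges V) (snd ` stars V P)"
  proof (rule partition_onI)
    show "{} \<notin> snd ` stars V P"
    proof
      assume "{} \<in> snd ` stars V P"
      then obtain c L where "c \<in> V" "L \<in> P c" "{} = snd (star c L)"
        by (auto simp: stars_def)
      then show False using ne(1)[of c L] by (auto simp: star_def)
    qed
  next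
    show "\<Union> (snd ` stars V P) = complete_edges V"
    proof
      show "\<Union> (snd ` stars V P) \<subseteq> complete_edges V"
      proof
        fix d assume "d \<in> \<Union> (snd ` stars V P)"
        then obtain c L x where c: "c \<in> V" "L \<in> P c" "x \<in> L" "d = {c, x}"
          by (auto simp: stars_def star_def)
        then have "x \<in> V" "x \<noteq> c" using sub[OF c(1,2)] out[OF c(1)] by auto
        then show "d \<in> complete_edges V"
          using c unfolding complete_edges_def by blast
      qed
      have *: "{x, y} \<in> \<Union> (snd ` stars V P)" if xy: "x \<in> V" "y \<in> out x" for x y
      proof -
        obtain L where L: "L \<in> P x" "y \<in> L"
          using P[OF xy(1)] xy(2) by (auto simp: partition_on_def)
        then have "star x L \<in> stars V P" "{x, y} \<in> snd (star x L)"
          using xy(1) by (auto simp: stars_def star_def)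
        then show ?thesis by blast
      qed
      show "complete_edges V \<subseteq> \<Union> (snd ` stars V P)"
      proof
        fix d assume "d \<in> complete_edges V"
        then obtain x y where xy: "x \<in> V" "y \<in> V" "x \<noteq> y" "d = {x, y}"
          by (auto simp: complete_edges_def)
        then show "d \<in> \<Union> (snd ` stars V P)"
          using tour[OF xy(1-3)] *[of x y] *[of y x] by (metis insert_commute)
      qed
    qed
  next
    fix p p' assume p: "p \<in> snd ` stars V P" "p' \<in> snd ` stars V P" "p \<noteq> p'"
    obtain c L where c: "c \<in> V" "L \<in> P c" "p = snd (star c L)"
      using p(1) by (auto simp: stars_def)
    obtain c' L' where c': "c' \<in> V" "L' \<in> P c'" "p' = snd (star c' L')"
      using p(2) by (auto simp: stars_def)
    show "disjnt p p'"
    proof (rule ccontr)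
      assume "\<not> disjnt p p'"
      then obtain d where d: "d \<in> p" "d \<in> p'" by (auto simp: disjnt_def)
      obtain x where x: "x \<in> L" "d = {c, x}" using d(1) c(3) by (auto simp: star_def)
      obtain x' where x': "x' \<in> L'" "d = {c', x'}" using d(2) c'(3) by (auto simp: star_def)
      have "{c, x} = {c', x'}" using x(2) x'(2) by simp
      then show False using eq[OF c(1,2) c'(1,2) x(1) x'(1)] c(3) c'(3) p(3) by simp
    qed
  qed
  ultimately show ?thesis
    using \<open>finite V\<close> by (auto simp: star_system_def)
qed

lemma colouring_stars_iff:
  assumes "\<And>x L. x \<in> V \<Longrightarrow> L \<in> P x \<Longrightarrow> L \<subseteq> V"
  shows "colouring k V (stars V P) f \<longleftrightarrow>
    f ` V \<subseteq> {..<k} \<and> (\<forall>c\<in>V. \<forall>L\<in>P c. \<exists>x\<in>L. f x \<noteq> f c)"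
proof -
  have "(\<forall>i<k. \<not> fst (star c L) \<subseteq> colour_class V f i) \<longleftrightarrow> (\<exists>x\<in>L. f x \<noteq> f c)"
    if "f ` V \<subseteq> {..<k}" "c \<in> V" "L \<in> P c" for c L
    using that assms[OF that(2,3)] by (auto simp: star_def colour_class_def)
  moreover have "stars V P = (\<Union>c\<in>V. star c ` P c)"
    by (auto simp: stars_def)
  ultimately show ?thesis
    unfolding colouring_def by (simp cong: conj_cong ball_cong)
qed

section \<open>Partitions into blocks of size \<open>e\<close> that all meet a given set\<close>

lemma partition_on_disjoint_Un:
  assumes "partition_on A P" "partition_on B Q" "A \<inter> B = {}"
  shows "partition_on (A \<union> B) (P \<union> Q)"
  using assms by (auto simp: partition_on_def disjoint_union)

text \<open>Each element of \<open>Z\<close> takes a share of \<open>m\<close> elements of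
  \<open>R\<close>, so \<open>Z\<close> becomes a transversal of the blocks.\<close>

lemma partition_by_transversal:
  assumes "finite Z" "finite R" "Z \<inter> R = {}" "card R = card Z * m"
  shows "\<exists>Q. partition_on (Z \<union> R) Q \<and> (\<forall>L\<in>Q. card L = Suc m \<and> L \<inter> Z \<noteq> {})"
  using assms
proof (induction Z arbitrary: R rule: finite_induct)
  case empty
  then show ?case by (intro exI[of _ "{}"]) (auto simp: partition_on_def)
next
  case (insert z Z)
  from insert have "m \<le> card R" by simp
  then obtain T where T: "T \<subseteq> R" "card T = m" "finite T"
    using obtain_subset_with_card_n by metis
  have "card (R - T) = card Z * m"
    using insert T by (simp add: card_Diff_subset)
  then obtain Q where Q: "partition_on (Z \<union> (R - T)) Q"
      "\<forall>L\<in>Q. card L = Suc m \<and> L \<inter> Z \<noteq> {}"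
    using insert.IH[of "R - T"] insert.prems by auto
  have "z \<notin> T" using T insert.prems by auto
  have "partition_on (insert z T \<union> (Z \<union> (R - T))) (insert (insert z T) Q)"
    using partition_on_disjoint_Un[OF partition_on_space[of "insert z T"] Q(1)]
      insert.hyps insert.prems T by auto
  moreover have "insert z T \<union> (Z \<union> (R - T)) = insert z Z \<union> R"
    using T by auto
  ultimately show ?case
    using Q(2) T \<open>z \<notin> T\<close> by (intro exI[of _ "insert (insert z T) Q"]) auto
qed

text \<open>There are \<open>s\<close> blocks to build, so any \<open>s\<close> elements of
  \<open>Y\<close> can serve as a transversal \<open>Z\<close>; the remaining
  \<open>s * (e - 1)\<close> elements of \<open>W\<close> fill the blocks up.\<close>

lemma partition_meeting:
  assumes "finite W" "Y \<subseteq> W" "card W = s * e" "s \<le> card Y" "e > 0"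
  shows "\<exists>Q. partition_on W Q \<and> (\<forall>L\<in>Q. card L = e \<and> L \<inter> Y \<noteq> {})"
proof -
  obtain Z where Z: "Z \<subseteq> Y" "card Z = s" "finite Z"
    using obtain_subset_with_card_n[OF assms(4)] by metis
  have "card (W - Z) = s * (e - 1)"
    using Z assms by (simp add: card_Diff_subset diff_mult_distrib2)
  then obtain Q where "partition_on (Z \<union> (W - Z)) Q"
      "\<forall>L\<in>Q. card L = Suc (e - 1) \<and> L \<inter> Z \<noteq> {}"
    using partition_by_transversal[of Z "W - Z" "e - 1"] Z assms by auto
  moreover have "Z \<union> (W - Z) = W" using Z assms by auto
  ultimately show ?thesis using Z \<open>e > 0\<close> by (intro exI[of _ Q]) auto
qed

text \<open>Set the prescribed blocks aside and partition the rest with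
  \<open>partition_meeting\<close>. Enough of \<open>Y\<close> must survive to give every remaining
  block an element, and this is where \<open>e \<ge> 3\<close> enters.\<close>

lemma partition_extending:
  assumes "finite W" "Y \<subseteq> W" "card W = 2 * j * e" "card Y = j * e" "e \<ge> 3"
    and F: "finite F" "disjoint F" "\<And>L. L \<in> F \<Longrightarrow> L \<subseteq> W \<and> card L = e \<and> L \<inter> Y \<noteq> {}"
    and small: "2 * card F \<le> j"
  shows "\<exists>Q. partition_on W Q \<and> F \<subseteq> Q \<and> (\<forall>L\<in>Q. card L = e \<and> L \<inter> Y \<noteq> {})"
proof -
  define U where "U = \<Union>F"
  have fin: "finite L" if "L \<in> F" for L using F(3)[OF that] assms(1) finite_subset by auto
  have U: "U \<subseteq> W" "finite U" using F(3) fin F(1) by (auto simp: U_def)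
  have cU: "card U = card F * e"
    unfolding U_def using F(2,3) fin
    by (subst card_Union_disjoint) (auto simp: disjoint_def pairwise_def disjnt_def)
  have 1: "card (W - U) = (2 * j - card F) * e"
    using U cU assms(3) by (simp add: card_Diff_subset diff_mult_distrib)
  \<comment> \<open>Worst case: the prescribed blocks lie entirely inside \<open>Y\<close>, leaving
    \<open>(j - card F) * e\<close> of its elements for \<open>2 * j - card F\<close> blocks.
    Already for \<open>e = 3\<close> this suffices, the inequality then being equivalent to
    \<open>2 * card F \<le> j\<close>.\<close>
  have "card Y - card U \<le> card (Y - U)"
    using U by (simp add: diff_card_le_card_Diff)
  moreover have "2 * j - card F \<le> (j - card F) * e"
  proof -
    have "2 * j - card F \<le> (j - card F) * 3" using small by simp
    also have "\<dots> \<le> (j - card F) * e" using assms by simp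
    finally show ?thesis .
  qed
  ultimately have "2 * j - card F \<le> card (Y - U)"
    using cU assms(4) by (simp add: diff_mult_distrib)
  then obtain Q where Q: "partition_on (W - U) Q" "\<forall>L\<in>Q. card L = e \<and> L \<inter> (Y - U) \<noteq> {}"
    using partition_meeting[of "W - U" "Y - U" "2 * j - card F" e] 1 assms by auto
  have "partition_on U F"
    using F(2,3) by (auto simp: partition_on_def U_def)
  then have "partition_on (U \<union> (W - U)) (F \<union> Q)"
    using Q(1) by (intro partition_on_disjoint_Un) auto
  moreover have "U \<union> (W - U) = W" using U by auto
  ultimately show ?thesis
    using Q(2) F(3) by (intro exI[of _ "F \<union> Q"]) auto
qed

section \<open>Parity cells and the orientation with out-degrees divisible by
  \<open>e\<close>\<close>

lemma card_parity_class:
  "card {w. w < 2 * m \<and> even w = b} = (m::nat)"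
proof -
  have "{w. w < 2 * m \<and> even w = b} = (\<lambda>i. 2 * i + of_bool (\<not> b)) ` {..<m}"
  proof (intro set_eqI iffI)
    fix w assume "w \<in> {w. w < 2 * m \<and> even w = b}"
    then show "w \<in> (\<lambda>i. 2 * i + of_bool (\<not> b)) ` {..<m}"
      by (intro image_eqI[of _ _ "w div 2"]) auto
  qed (auto split: if_splits simp: of_bool_def)
  then show ?thesis by (simp add: card_image inj_on_def)
qed

definition cell :: "nat \<Rightarrow> bool \<Rightarrow> nat \<Rightarrow> nat set" where
  "cell e b i = {v. v div (2 * e) = i \<and> even v = b}"

lemma cell_eq_image: "cell e b i = (\<lambda>v. 2 * e * i + v) ` {w. w < 2 * e \<and> even w = b}"
  if "e > 0"
proof (intro set_eqI iffI)
  fix v assume v: "v \<in> cell e b i"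
  have "v = 2 * e * i + v mod (2 * e)"
    using v by (auto simp: cell_def)
  moreover have "even (v mod (2 * e)) = even v"
    by (simp add: dvd_mod_iff)
  ultimately
  show "v \<in> (\<lambda>v. 2 * e * i + v) ` {w. w < 2 * e \<and> even w = b}"
    using v that by (intro image_eqI[of _ _ "v mod (2 * e)"]) (auto simp: cell_def)
next
  fix v assume "v \<in> (\<lambda>v. 2 * e * i + v) ` {w. w < 2 * e \<and> even w = b}"
  then show "v \<in> cell e b i" using that by (auto simp: cell_def)
qed

lemma card_cell: "e > 0 \<Longrightarrow> card (cell e b i) = e"
  by (simp add: cell_eq_image card_image inj_on_def card_parity_class)

lemma finite_cell: "e > 0 \<Longrightarrow> finite (cell e b i)"
  by (simp add: cell_eq_image)

lemma cell_first: "e > 0 \<Longrightarrow> 2 * e * i + of_bool (\<not> b) \<in> cell e b i"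
  by (auto simp: cell_eq_image)

text \<open>In a group of 2e vertices the first 2e - 1 form a regular tournament and all of them beat
  the last one, so the out-degrees are e, ..., e, 0.\<close>

definition inner :: "nat \<Rightarrow> nat \<Rightarrow> nat set" where
  "inner e v = {w. w div (2 * e) = v div (2 * e) \<and> v mod (2 * e) \<noteq> 2 * e - 1 \<and>
     (w mod (2 * e) = 2 * e - 1 \<or> v < w \<and> even v \<noteq> even w \<or> w < v \<and> even v = even w)}"

text \<open>Among the vertices other than the last of the group, the smaller one wins if the
  parities differ and the larger one if they agree. The last vertex loses to all others, and two
  distinct vertices of one group cannot both be last.\<close>

lemma inner_tournament:
  assumes "x \<noteq> y" "x div (2 * e) = y div (2 * e)"
  shows "(y \<in> inner e x) \<noteq> (x \<in> inner e y)"
proof -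
  have "x mod (2 * e) \<noteq> y mod (2 * e)"
    using assms by (metis div_mult_mod_eq)
  then show ?thesis using assms unfolding inner_def by auto
qed

text \<open>This is the rotational tournament on the residues modulo \<open>2 * e - 1\<close>:
  \<open>r\<close> beats \<open>s\<close> iff the representative of \<open>s - r\<close> between 0
  and \<open>2 * e - 2\<close> is odd, and there are \<open>e - 1\<close> such differences.\<close>

lemma card_regular_tournament_out:
  fixes e r :: nat
  assumes "r < 2 * e - 1"
  shows "card {s. s < 2 * e - 1 \<and> (r < s \<and> even r \<noteq> even s \<or> s < r \<and> even r = even s)} = e - 1"
    (is "card ?A = _")
proof -
  obtain k b where r: "r = 2 * k + b" "b < 2"
    using that[of "r div 2" "r mod 2"] by simp
  \<comment> \<open>Lists the out-neighbours in increasing order. The \<open>k\<close> of them below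
    \<open>r = 2 * k + b\<close> share its parity \<open>b\<close>; those above start at
    \<open>r + 1\<close>, so the offset grows by one at index \<open>k\<close>.\<close>
  define g where "g = (\<lambda>i. 2 * i + (if i < k then b else b + 1))"
  have "?A = g ` {..<e - 1}"
  proof (intro set_eqI iffI)
    fix s assume s: "s \<in> ?A"
    show "s \<in> g ` {..<e - 1}"
    proof (cases "s < r")
      case True
      with s r have "even (s + b)" by auto
      then have i: "s = 2 * (s div 2) + b" using r(2) by presburger
      with True r have "s div 2 < k" by linarith
      then show ?thesis
        using i r assms by (intro image_eqI[of _ _ "s div 2"]) (auto simp: g_def)
    next
      case False
      define i where "i = (s - b - 1) div 2"
      from False s r have "odd (s + b)" "s > b" by auto
      then have i: "s = 2 * i + b + 1" unfolding i_def using r(2) by presburger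
      with False r have "\<not> i < k" by linarith
      then show ?thesis using i s by (intro image_eqI[of _ _ i]) (auto simp: g_def)
    qed
  next
    fix s assume "s \<in> g ` {..<e - 1}"
    then obtain i where i: "i < e - 1" "s = g i" by auto
    show "s \<in> ?A"
      using i assms r by (cases "i < k") (auto simp: g_def less_2_cases_iff)
  qed
  moreover have "inj g"
  proof (rule injI)
    fix x y assume "g x = g y"
    then show "x = y" using r(2) unfolding g_def by (cases "x < k"; cases "y < k") auto
  qed
  ultimately show ?thesis by (simp add: card_image inj_on_subset)
qed

text \<open>The regular tournament contributes \<open>e - 1\<close> out-neighbours and the last
  vertex of the group one more. The group starts at an even number, so parity and order can be read
  off the residues.\<close>

lemma card_inner:
  assumes "e > 0" "v mod (2 * e) \<noteq> 2 * e - 1"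
  shows "card (inner e v) = e"
proof -
  define r where "r = v mod (2 * e)"
  define c where "c = 2 * e * (v div (2 * e))"
  define A where "A = {s. s < 2 * e - 1 \<and> (r < s \<and> even r \<noteq> even s \<or> s < r \<and> even r = even s)}"
  have v: "v = c + r" "even c" by (auto simp: c_def r_def)
  have "r < 2 * e" using assms(1) by (simp add: r_def)
  then have r: "r < 2 * e - 1" using assms(2) unfolding r_def by linarith
  have "inner e v = (\<lambda>s. c + s) ` insert (2 * e - 1) A"
  proof (intro set_eqI iffI)
    fix w assume w: "w \<in> inner e v"
    define s where "s = w mod (2 * e)"
    have ws: "w = c + s"
      using w unfolding inner_def c_def s_def by (metis (mono_tags, lifting) mem_Collect_eq mult_div_mod_eq)
    have "s < 2 * e" using assms by (simp add: s_def)
    moreover have "v < w \<longleftrightarrow> r < s" "w < v \<longleftrightarrow> s < r" "even v = even r" "even w = even s"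
      using v(2) unfolding v(1) ws by auto
    then have "s = 2 * e - 1 \<or> r < s \<and> even r \<noteq> even s \<or> s < r \<and> even r = even s"
      using w unfolding inner_def mem_Collect_eq s_def[symmetric] by blast
    ultimately show "w \<in> (\<lambda>s. c + s) ` insert (2 * e - 1) A"
      using ws by (auto simp: A_def)
  next
    fix w assume "w \<in> (\<lambda>s. c + s) ` insert (2 * e - 1) A"
    then obtain s where s: "w = c + s" "s = 2 * e - 1 \<or> s \<in> A" by auto
    then have "s < 2 * e" using assms by (auto simp: A_def)
    then have d: "w div (2 * e) = v div (2 * e)" "w mod (2 * e) = s"
      using s(1) by (auto simp: c_def)
    show "w \<in> inner e v"
      using s v assms d by (auto simp: inner_def A_def)
  qed
  moreover have "card A = e - 1" unfolding A_def by (rule card_regular_tournament_out[OF r])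
  moreover have "finite A" "2 * e - 1 \<notin> A" by (auto simp: A_def)
  ultimately show ?thesis
    using assms by (subst \<open>inner e v = _\<close>, subst card_image) (auto simp: inj_on_def)
qed

definition beaten :: "nat \<Rightarrow> nat \<Rightarrow> nat set" where
  "beaten e v = {..<2 * e * (v div (2 * e))} \<union> inner e v"

lemma less_group_iff: "w < 2 * e * j \<longleftrightarrow> w div (2 * e) < j" if "e > 0" for w e j :: nat
  using that by (simp add: div_less_iff_less_mult mult.commute)

lemma beaten_tournament:
  assumes "e > 0" "x \<noteq> y"
  shows "(y \<in> beaten e x) \<noteq> (x \<in> beaten e y)"
proof (cases "x div (2 * e) = y div (2 * e)")
  case True
  then show ?thesis
    using inner_tournament[OF assms(2)] assms(1) by (auto simp: beaten_def less_group_iff)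
next
  case False
  then have "y \<notin> inner e x" "x \<notin> inner e y" by (auto simp: inner_def)
  then show ?thesis using False assms(1) by (auto simp: beaten_def less_group_iff)
qed

lemma beaten_subset:
  assumes "e > 0" "v < 2 * e * t"
  shows "beaten e v \<subseteq> {..<2 * e * t} - {v}"
  using assms by (auto simp: beaten_def less_group_iff inner_def)

section \<open>The prescribed stars\<close>

text \<open>A cell of parity opposite to \<open>v\<close> whose colour is settled early. Even
  centres use group \<open>q + 1\<close>, since its odd vertices are themselves forced by the even
  cell of group \<open>q\<close>.\<close>

definition hub :: "nat \<Rightarrow> nat \<Rightarrow> nat \<Rightarrow> nat set" where
  "hub e q v = (if odd v then cell e True q else cell e False (q + 1))"

text \<open>The leaves of a star that forces the colour of vertex u, centred in group q + 3 + u.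
  One vertex of the cell is dropped to make room for u.\<close>

definition link :: "nat \<Rightarrow> nat \<Rightarrow> nat \<Rightarrow> nat set" where
  "link e q v = insert (v div (2 * e) - (q + 3))
     (cell e (even v) (q + 2) - {2 * e * (q + 2) + of_bool (odd v)})"

text \<open>The clauses follow the order in which colours get forced. \<open>S\<close> lists the
  \<open>e\<close>-subsets of the even vertices of groups 0 and 1, one for each of the groups 2 to
  \<open>K + 1\<close>. The value \<open>q = 2 * K + 2\<close> puts group \<open>q\<close> after all
  of these and makes room for \<open>K\<close> prescribed stars at each of its even vertices. The
  vertex \<open>u\<close> is the early vertex assigned to the group of \<open>v\<close>; if it lies
  in the hub, its colour is known already and a link would overlap the hub.\<close>

definition forcing :: "nat \<Rightarrow> nat \<Rightarrow> (nat \<Rightarrow> nat set) \<Rightarrow> nat \<Rightarrow> nat set set" where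
  "forcing e K S v =
    (let j = v div (2 * e); q = 2 * K + 2; u = j - (q + 3) in
     if 2 \<le> j \<and> j < K + 2 \<and> odd v then {S (j - 2)}
     else if j = q \<and> even v then cell e False ` {2..<K + 2}
     else if j = q + 1 \<and> odd v \<or> j = q + 2 then {hub e q v}
     else if j \<ge> q + 3 then
       (if even u = even v \<or> u \<in> hub e q v then {hub e q v} else {hub e q v, link e q v})
     else {})"

lemma card_link:
  assumes "e > 0" "even (v div (2 * e) - (q + 3)) \<noteq> even v"
  shows "card (link e q v) = e"
proof -
  have "2 * e * (q + 2) + of_bool (odd v) \<in> cell e (even v) (q + 2)"
    using cell_first[OF assms(1), of "q + 2" "even v"] by simp
  moreover have "v div (2 * e) - (q + 3) \<notin> cell e (even v) (q + 2)"
    using assms by (auto simp: cell_def)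
  ultimately show ?thesis
    using assms(1) by (simp add: link_def card_insert_if finite_cell card_cell)
qed

text \<open>These are the conditions on \<open>F\<close> in \<open>partition_extending\<close>, with
  the vertices of earlier groups as \<open>W\<close> and those of parity opposite to
  \<open>v\<close> as \<open>Y\<close>.\<close>

lemma forcing_props:
  fixes e K v :: nat
  assumes "e \<ge> 3"
    and S: "\<And>i. i < K \<Longrightarrow> card (S i) = e \<and> S i \<subseteq> cell e True 0 \<union> cell e True 1"
  defines "j \<equiv> v div (2 * e)"
  shows "finite (forcing e K S v)" "disjoint (forcing e K S v)" "2 * card (forcing e K S v) \<le> j"
    and "\<And>L. L \<in> forcing e K S v \<Longrightarrow>
      L \<subseteq> {..<2 * e * j} \<and> card L = e \<and> L \<inter> {w. w < 2 * e * j \<and> even w = odd v} \<noteq> {}"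
proof -
  define q where "q = 2 * K + 2"
  define u where "u = j - (q + 3)"
  define good where "good = (\<lambda>L. L \<subseteq> {..<2 * e * j} \<and> card L = e \<and>
    L \<inter> {w. w < 2 * e * j \<and> even w = odd v} \<noteq> {})"
  have e: "e > 0" using assms(1) by simp
  have opposite: "good L" if "L \<subseteq> {..<2 * e * j}" "card L = e" "\<And>w. w \<in> L \<Longrightarrow> even w = odd v" for L
  proof -
    have "L \<noteq> {}" using that(2) e by auto
    then show ?thesis using that unfolding good_def by blast
  qed
  have cell: "good (cell e (odd v) i)" if "i < j" for i
    using that e card_cell[OF e] by (intro opposite) (auto simp: cell_def less_group_iff)
  have F: "forcing e K S v =
    (if 2 \<le> j \<and> j < K + 2 \<and> odd v then {S (j - 2)}
     else if j = q \<and> even v then cell e False ` {2..<K + 2}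
     else if j = q + 1 \<and> odd v \<or> j = q + 2 then {hub e q v}
     else if j \<ge> q + 3 then
       (if even u = even v \<or> u \<in> hub e q v then {hub e q v} else {hub e q v, link e q v})
     else {})"
    by (simp add: forcing_def Let_def j_def q_def u_def)
  consider
      (S) "2 \<le> j" "j < K + 2" "odd v" "forcing e K S v = {S (j - 2)}"
    | (cells) "j = q" "even v" "forcing e K S v = cell e False ` {2..<K + 2}"
    | (hub) "j = q + 1 \<and> odd v \<or> j = q + 2 \<or> j \<ge> q + 3" "forcing e K S v = {hub e q v}"
    | (link) "j \<ge> q + 3" "even u \<noteq> even v" "u \<notin> hub e q v"
        "forcing e K S v = {hub e q v, link e q v}"
    | (none) "forcing e K S v = {}"
    using F by presburger
  then have "finite (forcing e K S v) \<and> disjoint (forcing e K S v) \<and>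
      2 * card (forcing e K S v) \<le> j \<and> (\<forall>L\<in>forcing e K S v. good L)"
  proof cases
    case S
    have "good (S (j - 2))"
    proof (rule opposite)
      have *: "card (S (j - 2)) = e" "S (j - 2) \<subseteq> cell e True 0 \<union> cell e True 1"
        using assms(2)[of "j - 2"] S by auto
      then show "card (S (j - 2)) = e" by simp
      show "S (j - 2) \<subseteq> {..<2 * e * j}"
        using * S e by (auto simp: cell_def less_group_iff)
      show "even w = odd v" if "w \<in> S (j - 2)" for w
        using * S that by (auto simp: cell_def)
    qed
    then show ?thesis using S by simp
  next
    case cells
    have "disjoint (cell e False ` {2..<K + 2})"
      by (auto simp: disjoint_def cell_def)
    moreover have "card (cell e False ` {2..<K + 2}) \<le> K"
      using card_image_le[of "{2..<K + 2}" "cell e False"] by simp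
    moreover have "good L" if L: "L \<in> cell e False ` {2..<K + 2}" for L
    proof -
      obtain i where "i < K + 2" "L = cell e False i" using L by auto
      then show ?thesis using cell[of i] cells by (simp add: q_def)
    qed
    ultimately show ?thesis using cells by (simp add: q_def)
  next
    case hub
    then have "good (hub e q v)" using cell[of q] cell[of "q + 1"] by (auto simp: hub_def)
    moreover have "2 \<le> j" using hub by (auto simp: q_def)
    ultimately show ?thesis using hub by simp
  next
    case link
    then have hub: "good (hub e q v)" using cell[of q] cell[of "q + 1"] by (auto simp: hub_def)
    have "u \<in> link e q v" by (simp add: link_def u_def j_def)
    moreover have "card (link e q v) = e"
      using card_link[OF e] link by (simp add: u_def j_def)
    moreover have "link e q v \<subseteq> {..<2 * e * j}"
    proof -
      have "u < 1 * j" using link by (simp add: u_def)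
      also have "\<dots> \<le> 2 * e * j" using e by (intro mult_right_mono) auto
      finally have "u < 2 * e * j" .
      moreover have "cell e (even v) (q + 2) \<subseteq> {..<2 * e * j}"
        using link e by (auto simp: cell_def less_group_iff)
      ultimately show ?thesis by (auto simp: link_def u_def j_def)
    qed
    ultimately have "good (link e q v)"
      using link unfolding good_def by auto
    \<comment> \<open>The hub has parity opposite to \<open>v\<close>, while the link consists of
      vertices of the parity of \<open>v\<close> together with \<open>u\<close>, which is outside
      the hub in this case.\<close>
    moreover have "hub e q v \<inter> link e q v = {}"
      using link by (auto simp: hub_def link_def cell_def u_def j_def)
    then have "disjoint {hub e q v, link e q v}"
      by (auto simp: disjoint_def)
    moreover have "card {hub e q v, link e q v} \<le> 2"
      by (simp add: card_insert_if)
    ultimately show ?thesis using hub link by (simp add: q_def)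
  next
    case none
    then show ?thesis by simp
  qed
  then show "finite (forcing e K S v)" "disjoint (forcing e K S v)" "2 * card (forcing e K S v) \<le> j"
    and "\<And>L. L \<in> forcing e K S v \<Longrightarrow>
      L \<subseteq> {..<2 * e * j} \<and> card L = e \<and> L \<inter> {w. w < 2 * e * j \<and> even w = odd v} \<noteq> {}"
    unfolding good_def by blast+
qed

text \<open>The earlier groups are handled by \<open>partition_extending\<close>;
  \<open>inner e v\<close>, when nonempty, is a single further block.\<close>

lemma beaten_partition:
  assumes "e \<ge> 3"
    and S: "\<And>i. i < K \<Longrightarrow> card (S i) = e \<and> S i \<subseteq> cell e True 0 \<union> cell e True 1"
  shows "\<exists>Q. partition_on (beaten e v) Q \<and> forcing e K S v \<subseteq> Q \<and>
    (\<forall>L\<in>Q. card L = e \<and> (\<exists>x\<in>L. even x = odd v))"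
proof -
  define j where "j = v div (2 * e)"
  have e: "e > 0" using assms(1) by simp
  have "\<exists>Q. partition_on {..<2 * e * j} Q \<and> forcing e K S v \<subseteq> Q \<and>
      (\<forall>L\<in>Q. card L = e \<and> L \<inter> {w. w < 2 * e * j \<and> even w = odd v} \<noteq> {})"
  proof (rule partition_extending[where j = j])
    show "card {w. w < 2 * e * j \<and> even w = odd v} = j * e"
      using card_parity_class[of "e * j" "odd v"] by (simp add: mult.assoc mult.commute[of j])
  qed (use assms(1) forcing_props[OF assms, where v = v] in \<open>simp_all add: j_def Collect_mono subset_eq\<close>)
  then obtain Q where Q: "partition_on {..<2 * e * j} Q" "forcing e K S v \<subseteq> Q"
      "\<forall>L\<in>Q. card L = e \<and> L \<inter> {w. w < 2 * e * j \<and> even w = odd v} \<noteq> {}"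
    by blast
  have Q4: "\<forall>L\<in>Q. card L = e \<and> (\<exists>x\<in>L. even x = odd v)"
    using Q(3) by blast
  show ?thesis
  \<comment> \<open>The set is empty exactly for the last vertex of a group, and a partition may not
    contain an empty block.\<close>
  proof (cases "inner e v = {}")
    case True
    then show ?thesis using Q(1,2) Q4 by (intro exI[of _ Q]) (auto simp: beaten_def j_def)
  next
    case False
    then have card: "card (inner e v) = e"
      using e by (intro card_inner) (auto simp: inner_def)
    have "\<exists>x\<in>inner e v. even x = odd v"
    \<comment> \<open>Counting: only \<open>e - 1\<close> other vertices of the group share the
      parity of \<open>v\<close>, too few for the \<open>e\<close> elements of
      \<open>inner e v\<close>.\<close>
    proof (rule ccontr)
      assume "\<not> ?thesis"
      then have "inner e v \<subseteq> cell e (even v) j - {v}"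
        by (auto simp: inner_def cell_def j_def)
      then have "card (inner e v) \<le> card (cell e (even v) j - {v})"
        using e by (intro card_mono) (auto simp: finite_cell)
      also have "v \<in> cell e (even v) j" by (simp add: cell_def j_def)
      then have "card (cell e (even v) j - {v}) = e - 1"
        using e by (simp add: card_cell)
      finally show False using card e by simp
    qed
    moreover have "partition_on (beaten e v) (Q \<union> {inner e v})"
      unfolding beaten_def j_def[symmetric]
      using Q(1) False e
      by (intro partition_on_disjoint_Un partition_on_space)
        (auto simp: less_group_iff inner_def j_def)
    ultimately show ?thesis
      using Q(2) Q4 card by (intro exI[of _ "Q \<union> {inner e v}"]) auto
  qed
qed

section \<open>Forcing the parity colouring\<close>

lemma monochromatic_subset:
  fixes f :: "'a \<Rightarrow> nat"
  assumes "finite X" "card X = 2 * e" "f ` X \<subseteq> {..<2}"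
  shows "\<exists>T a. T \<subseteq> X \<and> card T = e \<and> a < 2 \<and> (\<forall>x\<in>T. f x = a)"
proof -
  have X: "X = {x\<in>X. f x = 0} \<union> {x\<in>X. f x = 1}"
    using assms(3) by (auto simp: less_2_cases_iff)
  have "card X = card {x\<in>X. f x = 0} + card {x\<in>X. f x = 1}"
    using assms(1) by (subst X, subst card_Un_disjoint) auto
  then consider "e \<le> card {x\<in>X. f x = 0}" | "e \<le> card {x\<in>X. f x = 1}"
    using assms(2) by linarith
  then show ?thesis
  proof cases
    case 1
    then obtain T where "T \<subseteq> {x\<in>X. f x = 0}" "card T = e"
      using obtain_subset_with_card_n by metis
    then show ?thesis by (intro exI[of _ T] exI[of _ 0]) auto
  next
    case 2
    then obtain T where "T \<subseteq> {x\<in>X. f x = 1}" "card T = e"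
      using obtain_subset_with_card_n by metis
    then show ?thesis by (intro exI[of _ T] exI[of _ 1]) auto
  qed
qed

text \<open>Steps 1 to 4 run along the clauses of \<open>forcing\<close>, after which
  \<open>low\<close> returns to the early groups through the links. With
  \<open>q = 2 * K + 2\<close>, the number \<open>t\<close> of groups is \<open>q + 3\<close> plus
  one group for each of the \<open>2 * e * (q + 2)\<close> vertices of the groups before
  \<open>q + 2\<close>.\<close>

lemma parity_forced:
  fixes f :: "nat \<Rightarrow> nat"
  assumes "e \<ge> 3"
    and S: "S ` {..<K} = {T. T \<subseteq> cell e True 0 \<union> cell e True 1 \<and> card T = e}"
    and t: "t = 2 * K + 5 + 2 * e * (2 * K + 4)"
    and two: "\<And>v. v < 2 * e * t \<Longrightarrow> f v < 2"
    and proper: "\<And>v L. v < 2 * e * t \<Longrightarrow> L \<in> forcing e K S v \<Longrightarrow> \<exists>x\<in>L. f x \<noteq> f v"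
  shows "\<exists>a<2. \<forall>v<2 * e * t. f v = (if even v then a else 1 - a)"
proof -
  have e: "e > 0" using assms(1) by simp
  define q where "q = 2 * K + 2"
  have V: "v < 2 * e * t \<longleftrightarrow> v div (2 * e) < t" for v
    using e by (rule less_group_iff)
  have tq: "t = q + 3 + 2 * e * (q + 2)" "q + 3 < t"
    using t e by (auto simp: q_def numeral_eq_Suc)
  let ?X = "cell e True 0 \<union> cell e True 1"
  have "cell e True 0 \<inter> cell e True 1 = {}" by (auto simp: cell_def)
  then have "card ?X = 2 * e"
    using e by (simp add: card_Un_disjoint finite_cell card_cell)
  moreover have "f ` ?X \<subseteq> {..<2}"
    using two V tq by (auto simp: cell_def)
  ultimately obtain T a where T: "T \<subseteq> ?X" "card T = e" "a < 2" "\<forall>x\<in>T. f x = a"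
    using monochromatic_subset[of ?X e f] e by (auto simp: finite_cell)
  then have "T \<in> S ` {..<K}" using S by simp
  then obtain i where i: "i < K" "T = S i" by auto
  have forced: "f v = 1 - b"
    if "v div (2 * e) < t" "L \<in> forcing e K S v" "\<And>x. x \<in> L \<Longrightarrow> f x = b" "b < 2" for v L b
    using proper[of v L] two[of v] that V by (auto simp: less_2_cases_iff)
  have 1: "f v = 1 - a" if "v \<in> cell e False (i + 2)" for v
  proof (rule forced)
    show "S i \<in> forcing e K S v" "v div (2 * e) < t"
      using that i tq by (auto simp: forcing_def cell_def q_def)
  qed (use T i in auto)
  have 2: "f v = a" if "v \<in> cell e True q" for v
  proof -
    \<comment> \<open>The truncated difference \<open>1 - (1 - a)\<close> equals \<open>a\<close>
      because \<open>a < 2\<close>.\<close>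
    have "f v = 1 - (1 - a)"
    proof (rule forced)
      show "cell e False (i + 2) \<in> forcing e K S v" "v div (2 * e) < t"
        using that i tq by (auto simp: forcing_def cell_def q_def)
    qed (use 1 in auto)
    then show ?thesis using T by auto
  qed
  have 3: "f v = 1 - a" if "odd v" "q + 1 \<le> v div (2 * e)" "v div (2 * e) < t" for v
  proof (rule forced)
    show "cell e True q \<in> forcing e K S v"
      using that by (auto simp: forcing_def Let_def q_def hub_def)
  qed (use 2 T that in auto)
  have 4: "f v = a" if "even v" "q + 2 \<le> v div (2 * e)" "v div (2 * e) < t" for v
  proof -
    have "f v = 1 - (1 - a)"
    proof (rule forced)
      show "cell e False (q + 1) \<in> forcing e K S v"
        using that by (auto simp: forcing_def Let_def q_def hub_def)
      show "f x = 1 - a" if "x \<in> cell e False (q + 1)" for x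
        using that 3 tq by (auto simp: cell_def)
    qed (use that in auto)
    then show ?thesis using T by auto
  qed
  \<comment> \<open>Group \<open>q + 2\<close> is the first in which both parities are forced, so it
    can supply the leaves of the links.\<close>
  have high: "f v = (if even v then a else 1 - a)"
    if "q + 2 \<le> v div (2 * e)" "v div (2 * e) < t" for v
    using 3 4 that by auto
  have low: "f u = (if even u then a else 1 - a)" if u: "u div (2 * e) < q + 2" for u
  proof -
    have "u < 2 * e * (q + 2)" using u less_group_iff[OF e] by blast
    \<comment> \<open>The first vertex of parity opposite to \<open>u\<close> in the group assigned
      to \<open>u\<close>; groups start at even numbers.\<close>
    define v where "v = 2 * e * (q + 3 + u) + of_bool (even u)"
    have v: "v div (2 * e) = q + 3 + u" "even v = odd u"
      using cell_first[OF e, of "q + 3 + u" "odd u"] by (auto simp: v_def cell_def)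
    have vt: "v div (2 * e) < t" using v \<open>u < _\<close> tq by simp
    show ?thesis
    proof (cases "u \<in> hub e q v")
      case True
      then show ?thesis
        using 2 3 tq v(2) by (auto simp: hub_def cell_def split: if_splits)
    next
      case False
      then have "link e q v \<in> forcing e K S v"
        using v by (auto simp: forcing_def Let_def q_def)
      then obtain x where x: "x \<in> link e q v" "f x \<noteq> f v"
        using proper[of v] vt V by auto
      \<comment> \<open>The leaves of the link other than \<open>u\<close> agree with the centre in
        parity and hence in colour, so \<open>u\<close> is the only leaf that can differ from
        it.\<close>
      have "f x = f v" if "x \<in> cell e (even v) (q + 2)"
        using that high[of x] high[of v] vt v tq by (auto simp: cell_def)
      then have "x = u" using x v by (auto simp: link_def)
      moreover have "f v = (if even v then a else 1 - a)" using high vt v by simp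
      moreover have "u div (2 * e) < t" using u tq by simp
      ultimately show ?thesis
        using x(2) v(2) two[of u] V[of u] T(3) by (auto simp: less_2_cases_iff)
    qed
  qed
  show ?thesis
    using T(3) high low V by (meson not_le)
qed

section \<open>Assembling the system and checking its colourings\<close>

theorem theorem4p1:
  fixes e :: nat
  assumes "e \<ge> 3"
  shows "\<exists>(n::nat) (V :: nat set) (B :: nat subgraph set).
           [n = 0] (mod (2 * e)) \<and>
           star_system e n V B \<and>
           strongly_equitable_uniquely_chromatic 2 V B"
proof -
  have e: "e > 0" using assms by simp
  let ?M = "{T. T \<subseteq> cell e True 0 \<union> cell e True 1 \<and> card T = e}"
  define K where "K = card ?M"
  have "finite ?M" using e by (auto intro: finite_subset[OF _ finite_Pow_iff[THEN iffD2]] simp: finite_cell)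
  then obtain S where "bij_betw S {0..<K} ?M"
    unfolding K_def using ex_bij_betw_nat_finite by blast
  then have S: "S ` {..<K} = ?M" by (simp add: bij_betw_def atLeast0LessThan)
  then have S': "card (S i) = e \<and> S i \<subseteq> cell e True 0 \<union> cell e True 1" if "i < K" for i
    using that by blast
  obtain P where P: "\<And>v. partition_on (beaten e v) (P v)" "\<And>v. forcing e K S v \<subseteq> P v"
      "\<And>v L. L \<in> P v \<Longrightarrow> card L = e" "\<And>v L. L \<in> P v \<Longrightarrow> \<exists>x\<in>L. even x = odd v"
  proof -
    have "\<forall>v. \<exists>Q. partition_on (beaten e v) Q \<and> forcing e K S v \<subseteq> Q \<and>
        (\<forall>L\<in>Q. card L = e \<and> (\<exists>x\<in>L. even x = odd v))"
      by (intro allI beaten_partition assms S')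
    from choice[OF this] obtain P where "\<forall>v. partition_on (beaten e v) (P v) \<and>
        forcing e K S v \<subseteq> P v \<and> (\<forall>L\<in>P v. card L = e \<and> (\<exists>x\<in>L. even x = odd v))" ..
    then show ?thesis by (intro that[of P]) auto
  qed
  define t where "t = 2 * K + 5 + 2 * e * (2 * K + 4)"
  define V where "V = {..<2 * e * t}"
  define B where "B = stars V P"
  have LV: "L \<subseteq> V" if "v \<in> V" "L \<in> P v" for v L
    using that P(1)[of v] beaten_subset[OF e, of v t] by (auto simp: partition_on_def V_def)
  have col: "colouring k V B f \<longleftrightarrow>
      f ` V \<subseteq> {..<k} \<and> (\<forall>c\<in>V. \<forall>L\<in>P c. \<exists>x\<in>L. f x \<noteq> f c)" for k f
    unfolding B_def using LV by (rule colouring_stars_iff)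
  have sys: "star_system e (2 * e * t) V B"
    using star_system_stars[of V e "beaten e" P] beaten_tournament[OF e] beaten_subset[OF e, of _ t]
      P(1,3) e by (simp add: V_def B_def)
  have forced: "\<exists>a<2. \<forall>v\<in>V. f v = (if even v then a else 1 - a)" if "colouring 2 V B f" for f
  proof -
    have "\<exists>a<2. \<forall>v<2 * e * t. f v = (if even v then a else 1 - a)"
    proof (rule parity_forced[OF assms S t_def])
      show "f v < 2" if "v < 2 * e * t" for v
        using \<open>colouring 2 V B f\<close> that unfolding col by (auto simp: V_def)
      show "\<exists>x\<in>L. f x \<noteq> f v" if "v < 2 * e * t" "L \<in> forcing e K S v" for v L
        using \<open>colouring 2 V B f\<close> that P(2)[of v] unfolding col by (auto simp: V_def)
    qed
    then show ?thesis by (auto simp: V_def)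
  qed
  \<comment> \<open>Parity is a proper colouring since every block of \<open>P c\<close> contains a
    vertex of parity opposite to \<open>c\<close>.\<close>
  have "colouring 2 V B (\<lambda>v. v mod 2)"
    unfolding col
  proof (intro conjI ballI)
    fix c L assume "L \<in> P c"
    then obtain x where "x \<in> L" "even x = odd c" using P(4) by blast
    then show "\<exists>x\<in>L. x mod 2 \<noteq> c mod 2" by (metis even_iff_mod_2_eq_zero)
  qed auto
  then have two: "colourable 2 V B" by (auto simp: colourable_def)
  have one: "\<not> colourable 1 V B"
  proof
    assume "colourable 1 V B"
    then obtain f where f: "colouring 1 V B f" by (auto simp: colourable_def)
    have V0: "0 \<in> V" using e t_def by (simp add: V_def)
    \<comment> \<open>Vertex 0 beats the last vertex of its group, hence centres some star; with a
      single colour that star is monochromatic.\<close>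
    have "2 * e - 1 \<in> beaten e 0" using assms by (auto simp: beaten_def inner_def)
    then obtain L where L: "L \<in> P 0" using P(1)[of 0] by (auto simp: partition_on_def)
    then obtain x where x: "x \<in> L" "f x \<noteq> f 0" using f V0 unfolding col by blast
    have "f ` V \<subseteq> {..<1}" using f unfolding col by (rule conjunct1)
    then have "f x = 0" "f 0 = 0" using x(1) V0 LV[OF V0 L] by auto
    then show False using x(2) by simp
  qed
  have uniq: "\<exists>p. p permutes {..<2} \<and> (\<forall>v\<in>V. g v = p (f v))"
    if fg: "colouring 2 V B f" "colouring 2 V B g" for f g :: "nat \<Rightarrow> nat"
  proof -
    obtain a where a: "a < 2" "\<forall>v\<in>V. f v = (if even v then a else 1 - a)"
      using forced[OF fg(1)] by blast
    obtain b where b: "b < 2" "\<forall>v\<in>V. g v = (if even v then b else 1 - b)"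
      using forced[OF fg(2)] by blast
    \<comment> \<open>The colours of the even vertices under \<open>f\<close> and \<open>g\<close>
      are \<open>a\<close> and \<open>b\<close>; swapping them matches the odd vertices too, and for
      \<open>a = b\<close> the swap is the identity.\<close>
    have "transpose a b permutes {..<2}"
      using a(1) b(1) by (intro permutes_swap_id) auto
    moreover have "\<forall>v\<in>V. g v = transpose a b (f v)"
      using a b by (auto simp: less_2_cases_iff transpose_def)
    ultimately show ?thesis by blast
  qed
  have equitable: "strongly_equitable 2 V f" if f: "colouring 2 V B f" for f
  proof -
    obtain a where a: "a < 2" "\<forall>v\<in>V. f v = (if even v then a else 1 - a)"
      using forced[OF f] by blast
    have "card (colour_class V f i) = e * t" if "i < 2" for i
    proof -
      have "colour_class V f i = {v. v < 2 * (e * t) \<and> even v = (i = a)}"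
      proof (intro set_eqI)
        fix v
        have "f v = i \<longleftrightarrow> even v = (i = a)" if "v \<in> V"
          using a(1) bspec[OF a(2) that] \<open>i < 2\<close> by presburger
        then show "v \<in> colour_class V f i \<longleftrightarrow> v \<in> {v. v < 2 * (e * t) \<and> even v = (i = a)}"
          by (auto simp: colour_class_def V_def)
      qed
      then show ?thesis by (simp add: card_parity_class)
    qed
    then show ?thesis by (simp add: strongly_equitable_def)
  qed
  have "strongly_equitable_uniquely_chromatic 2 V B"
    unfolding strongly_equitable_uniquely_chromatic_def chromatic_def uniquely_colourable_def
    using two one by (intro conjI allI impI uniq equitable) simp_all
  moreover have "[2 * e * t = 0] (mod (2 * e))" by (simp add: cong_def)
  ultimately show ?thesis using sys by (intro exI conjI)
qed

end
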